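(* Let an $\mathrm{AVI}(C,q,M)$ be given, with $C\subset\mathbb{R}^n$ a nonempty polyhedral convex set, $q\in\mathbb{R}^n$ and $M\in\mathbb{R}^{n\times n}$ invertible on the lineality space of $C$. Suppose PathAVI generates a path (1-manifold) in $G_C^{-1}(0)$ with a ray start at an implicit extreme point of $C$, and assume that either $0$ is a regular value of $G_C$ or lexicographic pivoting is used. Then for each ray of the generated path, in a direction $(\Delta x,\Delta t)\neq0$, if $\Delta x\ne0$ then $\Delta\tilde x:=\bar Q^T\Delta x\neq 0$ and the corresponding piece of $\tilde G_{\tilde C}^{-1}(0)$ (the image of the ray under $(x,t)\mapsto(\bar Q^Tx,t)$) is a ray in $\tilde G_{\tilde C}^{-1}(0)$ in the direction $(\Delta\tilde x,\Delta t)$.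
   Context: $\mathrm{AVI}(C,q,M)$: find $z\in C$ with $\langle Mz+q,y-z\rangle\ge0$ for all $y\in C$. $Q$ and $\bar Q$ have as columns orthonormal bases of $\operatorname{lin}C$ (lineality space) and $(\operatorname{lin}C)^\perp$; $M_{PR}:=P^TMR$. "$M$ is invertible on the lineality space of $C$" means $Q^TMQ$ is invertible. $\pi_S$ is the Euclidean projection onto $S$; $N_C(z)=\{y:\langle y,z'-z\rangle\le0\ \forall z'\in C\}$. $G_C(x,t)=M\pi_C(x)+q+x-\pi_C(x)-tr$ on $\mathbb{R}^n\times\mathbb{R}_+$. The reduced map is $\tilde G_{\tilde C}(\tilde x,t)=\tilde M\pi_{\tilde C}(\tilde x)+\tilde q+\tilde x-\pi_{\tilde C}(\tilde x)-t\tilde r$, with $\tilde C=\bar Q^TC$, $\tilde M=M_{\bar Q\bar Q}-M_{\bar QQ}M_{QQ}^{-1}M_{Q\bar Q}$, $\tilde q=(\bar Q^T-M_{\bar QQ}M_{QQ}^{-1}Q^T)q$, $\tilde r=\bar Q^Tr$. Cells: for each nonempty face $F$ of $C$, let $N_F$ be the constant value of $N_C$ on $\operatorname{ri}F$; the sets $(F+N_F)\times\mathbb{R}_+$ are the $(n+1)$-cells of the manifold $\mathcal{M}_C$, and their $k$-dimensional faces its $k$-cells; $G_C$ is affine on each cell. $0$ is a regular value of $G_C$ if for every $(x,t)\in G_C^{-1}(0)$ and every cell $\tau$ (of any dimension) of $\mathcal{M}_C$ containing $(x,t)$, $\dim G_C(\tau)=n$. A point $z\in C$ is an implicit extreme point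 of $C$ if $z=\lambda z^1+(1-\lambda)z^2$ with $z^1,z^2\in C$, $\lambda\in(0,1)$ implies $z-z^1,z-z^2\in\operatorname{lin}C$. PathAVI. Write $C=\{z: Az-b\in K,\ l\le z\le u\}$ with $K$ a Cartesian product of copies of $\mathbb{R}_+,\{0\},\mathbb{R}_-$, and $K^D$ its dual cone. The method chooses an implicit extreme point $\bar z$ of $C$ with $M\bar z+q\in\operatorname{aff}(N_C(\bar z))$ and $r\in\operatorname{ri}(N_C(\bar z))$. For all large $t$ there is $x(t)$ with $\pi_C(x(t))=\bar z$ and $G_C(x(t),t)=0$ (the starting ray). From this ray, with $t$ decreasing, it follows the piecewise linear path in $G_C^{-1}(0)$ by complementary pivoting on $Mz+q-A^T\lambda-w+v=tr$, $Az-b=s$, $K\ni s\perp\lambda\in K^D$, $0\le z-l\perp w\ge0$, $0\le u-z\perp v\ge0$, $t\ge0$, where $x=z-A^T\lambda-w+v$ (the complement of the variable that just left the basis enters). Each pivot yields one piece of the path, which is the intersection of a line with one $(n+1)$-cell of $\mathcal{M}_C$ (under lexicographic pivoting: for the lexicographically perturbed system); no cell is traversed twice. The method stops when $t=0$ or when a piece is unbounded (a secondary ray). A ray of the path in direction $(\Delta x,\Delta t)$ is the starting ray or a secondary ray: a half-line $\{(x+\theta\Delta x,t+\theta\Delta t):\theta\ge0\}$ contained in $G_C^{-1}(0)$ and in one $(n+1)$-cell. *)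

theory Defs
  imports "HOL-Analysis.Analysis"
begin

section \<open>Polyhedral sets, normal cones and the cell complex\<close>

definition lineality_space :: "(real^'n) set \<Rightarrow> (real^'n) set" where
  "lineality_space C = {v. \<forall>z\<in>C. \<forall>a::real. z + a *\<^sub>R v \<in> C}"

definition implicit_extreme_point :: "(real^'n) set \<Rightarrow> real^'n \<Rightarrow> bool" where
  "implicit_extreme_point C z \<longleftrightarrow> z \<in> C \<and>
     (\<forall>z1\<in>C. \<forall>z2\<in>C. \<forall>\<mu>::real. 0 < \<mu> \<longrightarrow> \<mu> < 1 \<longrightarrow> z = \<mu> *\<^sub>R z1 + (1 - \<mu>) *\<^sub>R z2 \<longrightarrow>
        z - z1 \<in> lineality_space C \<and> z - z2 \<in> lineality_space C)"

text \<open>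
  The lineality space and its complement have arbitrary dimensions, 0 included, whereas an index
  type is never empty.  Therefore the Euclidean space of dimension \<open>card I\<close> is rendered as the
  coordinate subspace \<open>coord_space I\<close> of \<open>real^'n\<close>, with \<open>I\<close> a set of indices.  A matrix with
  \<open>card I\<close> columns is padded with zero columns outside \<open>I\<close>, so that \<open>transpose Q\<close> maps into
  \<open>coord_space I\<close> and \<open>transpose Q ** M ** Q\<close> vanishes outside the block \<open>I \<times> I\<close>.
  The notions of this section take the ambient subspace \<open>V\<close> as an argument:
  \<open>V = UNIV\<close> for the original problem and \<open>V = coord_space J\<close> for the reduced one.
\<close>

definition coord_space :: "'n set \<Rightarrow> (real^'n) set" where
  "coord_space I = {x. \<forall>i. i \<notin> I \<longrightarrow> x $ i = 0}"

definition orthonormal_basis_matrix :: "'n set \<Rightarrow> real^'n^'n \<Rightarrow> (real^'n) set \<Rightarrow> bool" where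
  "orthonormal_basis_matrix I Q S \<longleftrightarrow>
     (\<forall>i. i \<notin> I \<longrightarrow> column i Q = 0) \<and>
     (\<forall>i\<in>I. \<forall>j\<in>I. column i Q \<bullet> column j Q = (if i = j then 1 else 0)) \<and>
     span ((\<lambda>i. column i Q) ` I) = S"

definition block_id :: "'n set \<Rightarrow> real^'n^'n" where
  "block_id I = (\<chi> i j. if i = j \<and> i \<in> I then 1 else 0)"

text \<open>\<open>N\<close> is the inverse of the \<open>I \<times> I\<close> block of \<open>A\<close>, padded with zeros.\<close>

definition is_block_inverse :: "'n set \<Rightarrow> real^'n^'n \<Rightarrow> real^'n^'n \<Rightarrow> bool" where
  "is_block_inverse I A N \<longleftrightarrow> (\<forall>i j. i \<notin> I \<or> j \<notin> I \<longrightarrow> N $ i $ j = 0) \<and>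
     A ** N = block_id I \<and> N ** A = block_id I"

definition block_invertible :: "'n set \<Rightarrow> real^'n^'n \<Rightarrow> bool" where
  "block_invertible I A \<longleftrightarrow> (\<exists>N. is_block_inverse I A N)"

definition block_inv :: "'n set \<Rightarrow> real^'n^'n \<Rightarrow> real^'n^'n" where
  "block_inv I A = (SOME N. is_block_inverse I A N)"

definition normal_cone :: "(real^'n) set \<Rightarrow> (real^'n) set \<Rightarrow> real^'n \<Rightarrow> (real^'n) set" where
  "normal_cone V C z = {y\<in>V. \<forall>z'\<in>C. y \<bullet> (z' - z) \<le> 0}"

definition face_normal_cone :: "(real^'n) set \<Rightarrow> (real^'n) set \<Rightarrow> (real^'n) set \<Rightarrow> (real^'n) set" where
  "face_normal_cone V C F = (THE N. \<forall>z\<in>rel_interior F. normal_cone V C z = N)"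

definition top_cells :: "(real^'n) set \<Rightarrow> (real^'n) set \<Rightarrow> ((real^'n) \<times> real) set set" where
  "top_cells V C =
     {{f + y | f y. f \<in> F \<and> y \<in> face_normal_cone V C F} \<times> {0..} | F. F face_of C \<and> F \<noteq> {}}"

definition cells :: "(real^'n) set \<Rightarrow> (real^'n) set \<Rightarrow> ((real^'n) \<times> real) set set" where
  "cells V C = {\<tau>. \<tau> \<noteq> {} \<and> (\<exists>\<sigma>\<in>top_cells V C. \<tau> face_of \<sigma>)}"

definition Gmap :: "(real^'n) set \<Rightarrow> real^'n^'n \<Rightarrow> real^'n \<Rightarrow> real^'n \<Rightarrow> (real^'n) \<times> real \<Rightarrow> real^'n" where
  "Gmap C M q r = (\<lambda>(x, t). M *v closest_point C x + q + x - closest_point C x - t *\<^sub>R r)"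

definition Gzero :: "(real^'n) set \<Rightarrow> (real^'n) set \<Rightarrow> real^'n^'n \<Rightarrow> real^'n \<Rightarrow> real^'n
    \<Rightarrow> ((real^'n) \<times> real) set" where
  "Gzero V C M q r = {(x, t). x \<in> V \<and> 0 \<le> t \<and> Gmap C M q r (x, t) = 0}"

definition regular_value_zero :: "(real^'n) set \<Rightarrow> real^'n^'n \<Rightarrow> real^'n \<Rightarrow> real^'n \<Rightarrow> bool" where
  "regular_value_zero C M q r \<longleftrightarrow>
     (\<forall>xt\<in>Gzero UNIV C M q r. \<forall>\<tau>\<in>cells UNIV C. xt \<in> \<tau> \<longrightarrow>
        aff_dim (Gmap C M q r ` \<tau>) = int CARD('n))"
  for C :: "(real^'n) set"

definition halfline :: "(real^'n) \<times> real \<Rightarrow> (real^'n) \<times> real \<Rightarrow> ((real^'n) \<times> real) set" where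
  "halfline a d = {a + \<theta> *\<^sub>R d | \<theta>. 0 \<le> \<theta>}"

definition ray_in_Gzero :: "(real^'n) set \<Rightarrow> (real^'n) set \<Rightarrow> real^'n^'n \<Rightarrow> real^'n \<Rightarrow> real^'n
    \<Rightarrow> ((real^'n) \<times> real) set \<Rightarrow> (real^'n) \<times> real \<Rightarrow> bool" where
  "ray_in_Gzero V C M q r R d \<longleftrightarrow>
     d \<noteq> 0 \<and> (\<exists>a. R = halfline a d) \<and> R \<subseteq> Gzero V C M q r \<and> (\<exists>\<sigma>\<in>top_cells V C. R \<subseteq> \<sigma>)"


section \<open>The reduced problem\<close>

definition reduced_set :: "real^'n^'n \<Rightarrow> (real^'n) set \<Rightarrow> (real^'n) set" where
  "reduced_set Qbar C = (\<lambda>z. transpose Qbar *v z) ` C"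

definition reduced_matrix :: "'n set \<Rightarrow> real^'n^'n \<Rightarrow> real^'n^'n \<Rightarrow> real^'n^'n \<Rightarrow> real^'n^'n" where
  "reduced_matrix I Q Qbar M =
     transpose Qbar ** M ** Qbar
     - (transpose Qbar ** M ** Q) ** block_inv I (transpose Q ** M ** Q) ** (transpose Q ** M ** Qbar)"

definition reduced_q :: "'n set \<Rightarrow> real^'n^'n \<Rightarrow> real^'n^'n \<Rightarrow> real^'n^'n \<Rightarrow> real^'n \<Rightarrow> real^'n" where
  "reduced_q I Q Qbar M q =
     (transpose Qbar
      - (transpose Qbar ** M ** Q) ** block_inv I (transpose Q ** M ** Q) ** transpose Q) *v q"

definition reduced_r :: "real^'n^'n \<Rightarrow> real^'n \<Rightarrow> real^'n" where
  "reduced_r Qbar r = transpose Qbar *v r"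


section \<open>PathAVI\<close>

datatype cone_kind = Nonneg | Zero | Nonpos

fun kind_set :: "cone_kind \<Rightarrow> real set" where
  "kind_set Nonneg = {0..}"
| "kind_set Zero = {0}"
| "kind_set Nonpos = {..0}"

definition cone_product :: "('m \<Rightarrow> cone_kind) \<Rightarrow> (real^'m) set" where
  "cone_product kd = {s. \<forall>i. s $ i \<in> kind_set (kd i)}"

definition dual_cone :: "(real^'m) set \<Rightarrow> (real^'m) set" where
  "dual_cone K = {y. \<forall>s\<in>K. 0 \<le> y \<bullet> s}"

text \<open>Data of a PathAVI run; infinite entries of the bounds mean that the bound is absent.\<close>

record ('n::finite, 'm::finite) pathavi_data =
  Mmat :: "real^'n^'n"
  qvec :: "real^'n"
  rvec :: "real^'n"
  Amat :: "real^'n^'m"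
  bvec :: "real^'m"
  kind :: "'m \<Rightarrow> cone_kind"
  lbd :: "ereal^'n"
  ubd :: "ereal^'n"

definition within_bounds :: "('n::finite, 'm::finite) pathavi_data \<Rightarrow> real^'n \<Rightarrow> bool" where
  "within_bounds P z \<longleftrightarrow> (\<forall>j. lbd P $ j \<le> ereal (z $ j) \<and> ereal (z $ j) \<le> ubd P $ j)"

definition feasible_set :: "('n::finite, 'm::finite) pathavi_data \<Rightarrow> (real^'n) set" where
  "feasible_set P = {z. Amat P *v z - bvec P \<in> cone_product (kind P) \<and> within_bounds P z}"

text \<open>A point of the pivoting system is a tuple \<open>(z, \<lambda>, w, v, s, t)\<close>.\<close>

type_synonym ('n, 'm) pt =
  "(real^'n) \<times> (real^'m) \<times> (real^'n) \<times> (real^'n) \<times> (real^'m) \<times> real"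

datatype ('n, 'm) pvar = Zv 'n | Lv 'm | Wv 'n | Vv 'n | Sv 'm | Tv

fun val :: "('n::finite, 'm::finite) pt \<Rightarrow> ('n, 'm) pvar \<Rightarrow> real" where
  "val (z, la, w, v, s, t) (Zv j) = z $ j"
| "val (z, la, w, v, s, t) (Lv i) = la $ i"
| "val (z, la, w, v, s, t) (Wv j) = w $ j"
| "val (z, la, w, v, s, t) (Vv j) = v $ j"
| "val (z, la, w, v, s, t) (Sv i) = s $ i"
| "val (z, la, w, v, s, t) Tv = t"

definition zpart :: "('n::finite, 'm::finite) pt \<Rightarrow> real^'n" where
  "zpart p = fst p"

definition xt_of :: "('n::finite, 'm::finite) pathavi_data \<Rightarrow> ('n, 'm) pt \<Rightarrow> (real^'n) \<times> real" where
  "xt_of P = (\<lambda>(z, la, w, v, s, t). (z - transpose (Amat P) *v la - w + v, t))"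

text \<open>The linear equations, with the right-hand side perturbed by \<open>e\<close> (\<open>e = 0\<close>: no perturbation).\<close>

definition equations :: "('n::finite, 'm::finite) pathavi_data \<Rightarrow> real^('n + 'm) \<Rightarrow> ('n, 'm) pt \<Rightarrow> bool" where
  "equations P e = (\<lambda>(z, la, w, v, s, t).
     Mmat P *v z + qvec P - transpose (Amat P) *v la - w + v - t *\<^sub>R rvec P = (\<chi> j. e $ Inl j) \<and>
     Amat P *v z - bvec P - s = (\<chi> i. e $ Inr i))"

definition sign_feasible :: "('n::finite, 'm::finite) pathavi_data \<Rightarrow> ('n, 'm) pt \<Rightarrow> bool" where
  "sign_feasible P = (\<lambda>(z, la, w, v, s, t).
     within_bounds P z \<and> s \<in> cone_product (kind P) \<and> la \<in> dual_cone (cone_product (kind P)) \<and>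
     (\<forall>j. 0 \<le> w $ j \<and> 0 \<le> v $ j) \<and> 0 \<le> t)"

text \<open>
  A selection \<open>X\<close> consists of a basis together with the entering variable: \<open>t\<close> and exactly one
  variable out of each of the groups \<open>{z\<^sub>j, w\<^sub>j, v\<^sub>j}\<close> and \<open>{\<lambda>\<^sub>i, s\<^sub>i}\<close>; this is one variable more than
  there are equations.  The variables outside \<open>X\<close> are fixed: \<open>z\<^sub>j\<close> at its lower (upper) bound
  if \<open>w\<^sub>j\<close> (\<open>v\<^sub>j\<close>) is in \<open>X\<close>, all others at 0.  This enforces the complementarity conditions, so that
  \<open>sel_piece\<close> is one piece of the path and \<open>sel_dir\<close> is the direction space of its line.
\<close>

definition complementary_selection :: "('n::finite, 'm::finite) pvar set \<Rightarrow> bool" where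
  "complementary_selection X \<longleftrightarrow> Tv \<in> X \<and>
     (\<forall>j. card (X \<inter> {Zv j, Wv j, Vv j}) = 1) \<and> (\<forall>i. card (X \<inter> {Lv i, Sv i}) = 1)"

definition at_nonbasic_values :: "('n::finite, 'm::finite) pathavi_data \<Rightarrow> ('n, 'm) pvar set \<Rightarrow> ('n, 'm) pt \<Rightarrow> bool" where
  "at_nonbasic_values P X p \<longleftrightarrow>
     (\<forall>j. Zv j \<notin> X \<longrightarrow> ereal (val p (Zv j)) = (if Wv j \<in> X then lbd P $ j else ubd P $ j)) \<and>
     (\<forall>j. Wv j \<notin> X \<longrightarrow> val p (Wv j) = 0) \<and> (\<forall>j. Vv j \<notin> X \<longrightarrow> val p (Vv j) = 0) \<and>
     (\<forall>i. Lv i \<notin> X \<longrightarrow> val p (Lv i) = 0) \<and> (\<forall>i. Sv i \<notin> X \<longrightarrow> val p (Sv i) = 0)"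

definition sel_piece :: "('n::finite, 'm::finite) pathavi_data \<Rightarrow> real^('n + 'm)
    \<Rightarrow> ('n, 'm) pvar set \<Rightarrow> ('n, 'm) pt set" where
  "sel_piece P e X = {p. equations P e p \<and> sign_feasible P p \<and> at_nonbasic_values P X p}"

definition sel_dir :: "('n::finite, 'm::finite) pathavi_data \<Rightarrow> ('n, 'm) pvar set \<Rightarrow> ('n, 'm) pt set" where
  "sel_dir P X = {(z, la, w, v, s, t).
     Mmat P *v z - transpose (Amat P) *v la - w + v - t *\<^sub>R rvec P = 0 \<and> Amat P *v z - s = 0 \<and>
     (\<forall>y. y \<notin> X \<longrightarrow> val (z, la, w, v, s, t) y = 0)}"

text \<open>
  \<open>exchange P p d x y \<sigma>\<close>: at the point \<open>p\<close> the variable \<open>x\<close> is at a bound that blocks the direction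
  \<open>d\<close>; if it leaves the basis, its complement \<open>y\<close> enters, increasing for \<open>\<sigma> = 1\<close> and decreasing for
  \<open>\<sigma> = -1\<close>.  A multiplier \<open>\<lambda>\<^sub>i\<close> of an equality row is free and never blocks.
\<close>

inductive exchange :: "('n::finite, 'm::finite) pathavi_data \<Rightarrow> ('n, 'm) pt \<Rightarrow> ('n, 'm) pt
    \<Rightarrow> ('n, 'm) pvar \<Rightarrow> ('n, 'm) pvar \<Rightarrow> real \<Rightarrow> bool" for P p d where
  "ereal (val p (Zv j)) = lbd P $ j \<Longrightarrow> val d (Zv j) < 0 \<Longrightarrow> exchange P p d (Zv j) (Wv j) 1"
| "ereal (val p (Zv j)) = ubd P $ j \<Longrightarrow> val d (Zv j) > 0 \<Longrightarrow> exchange P p d (Zv j) (Vv j) 1"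
| "val p (Wv j) = 0 \<Longrightarrow> val d (Wv j) < 0 \<Longrightarrow> exchange P p d (Wv j) (Zv j) 1"
| "val p (Vv j) = 0 \<Longrightarrow> val d (Vv j) < 0 \<Longrightarrow> exchange P p d (Vv j) (Zv j) (- 1)"
| "kind P i \<noteq> Nonpos \<Longrightarrow> val p (Sv i) = 0 \<Longrightarrow> val d (Sv i) < 0 \<Longrightarrow> exchange P p d (Sv i) (Lv i) 1"
| "kind P i \<noteq> Nonneg \<Longrightarrow> val p (Sv i) = 0 \<Longrightarrow> val d (Sv i) > 0 \<Longrightarrow> exchange P p d (Sv i) (Lv i) (- 1)"
| "kind P i = Nonneg \<Longrightarrow> val p (Lv i) = 0 \<Longrightarrow> val d (Lv i) < 0 \<Longrightarrow> exchange P p d (Lv i) (Sv i) 1"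
| "kind P i = Nonpos \<Longrightarrow> val p (Lv i) = 0 \<Longrightarrow> val d (Lv i) > 0 \<Longrightarrow> exchange P p d (Lv i) (Sv i) (- 1)"

text \<open>
  A complete pivoting run with selections \<open>X 0, \<dots>, X k\<close>.  The piece of \<open>X 0\<close> contains the starting
  ray \<open>{p 0 - \<theta> d 0}\<close>, traversed with decreasing \<open>t\<close>; for \<open>0 < i \<le> k\<close> the piece of \<open>X i\<close> is entered
  at \<open>p i\<close> and traversed in direction \<open>d i\<close>.  Ratio test ties may be broken arbitrarily.
\<close>

definition pivoting_run :: "('n::finite, 'm::finite) pathavi_data \<Rightarrow> real^('n + 'm) \<Rightarrow> nat
    \<Rightarrow> (nat \<Rightarrow> ('n, 'm) pvar set) \<Rightarrow> (nat \<Rightarrow> ('n, 'm) pt) \<Rightarrow> (nat \<Rightarrow> ('n, 'm) pt) \<Rightarrow> bool" where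
  "pivoting_run P e k X p d \<longleftrightarrow>
     \<comment> \<open>start: \<open>X 0 - {t}\<close> is a nonsingular basis\<close>
     complementary_selection (X 0) \<and>
     (\<forall>g\<in>sel_dir P (X 0). val g Tv = 0 \<longrightarrow> g = 0) \<and>
     d 0 \<in> sel_dir P (X 0) \<and> val (d 0) Tv < 0 \<and>
     (\<forall>\<theta>\<ge>0. p 0 - \<theta> *\<^sub>R d 0 \<in> sel_piece P e (X 0)) \<and>
     \<comment> \<open>pivots\<close>
     (\<forall>i<k. (\<exists>\<theta>\<ge>0. p (Suc i) = p i + \<theta> *\<^sub>R d i) \<and> p (Suc i) \<in> sel_piece P e (X i) \<and>
        (\<exists>x y \<sigma>. x \<in> X i \<and> exchange P (p (Suc i)) (d i) x y \<sigma> \<and>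
           X (Suc i) = insert y (X i - {x}) \<and>
           d (Suc i) \<in> sel_dir P (X (Suc i)) \<and> 0 < \<sigma> * val (d (Suc i)) y)) \<and>
     inj_on X {..k} \<and>
     \<comment> \<open>stop: not before, but at the end, \<open>t = 0\<close> or an unbounded piece\<close>
     (\<forall>i\<le>k. 0 < val (p i) Tv) \<and>
     ((\<forall>\<theta>\<ge>0. p k + \<theta> *\<^sub>R d k \<in> sel_piece P e (X k)) \<or>
      (\<exists>\<theta>\<ge>0. p k + \<theta> *\<^sub>R d k \<in> sel_piece P e (X k) \<and> val (p k + \<theta> *\<^sub>R d k) Tv = 0))"

text \<open>
  Lexicographic pivoting: one sequence of selections is a pivoting run of the system perturbed by
  \<open>D (\<epsilon>, \<epsilon>\<^sup>2, \<dots>)\<close>, \<open>D\<close> nonsingular, for all small \<open>\<epsilon> > 0\<close>; the points of the unperturbed path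
  are the limits for \<open>\<epsilon> \<rightarrow> 0\<close>.  The directions do not depend on the right-hand side.
\<close>

definition lex_perturbation :: "real^('n + 'm)^('n + 'm) \<Rightarrow> ('n + 'm \<Rightarrow> nat) \<Rightarrow> real
    \<Rightarrow> real^('n::finite + 'm::finite)" where
  "lex_perturbation D ord \<epsilon> = D *v (\<chi> a. \<epsilon> ^ ord a)"

definition lex_pivoting_run :: "('n::finite, 'm::finite) pathavi_data \<Rightarrow> nat
    \<Rightarrow> (nat \<Rightarrow> ('n, 'm) pvar set) \<Rightarrow> (nat \<Rightarrow> ('n, 'm) pt) \<Rightarrow> (nat \<Rightarrow> ('n, 'm) pt) \<Rightarrow> bool" where
  "lex_pivoting_run P k X p d \<longleftrightarrow>
     (\<exists>(D :: real^('n + 'm)^('n + 'm)) ord pe.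
        invertible D \<and> bij_betw ord UNIV {1..CARD('n + 'm)} \<and>
        (\<forall>\<^sub>F \<epsilon> in at_right 0. pivoting_run P (lex_perturbation D ord \<epsilon>) k X (pe \<epsilon>) d) \<and>
        (\<forall>i\<le>k. ((\<lambda>\<epsilon>. pe \<epsilon> i) \<longlongrightarrow> p i) (at_right 0)))"

definition pathavi_path :: "('n::finite, 'm::finite) pathavi_data \<Rightarrow> real^'n \<Rightarrow> bool \<Rightarrow> nat
    \<Rightarrow> (nat \<Rightarrow> ('n, 'm) pvar set) \<Rightarrow> (nat \<Rightarrow> ('n, 'm) pt) \<Rightarrow> (nat \<Rightarrow> ('n, 'm) pt) \<Rightarrow> bool" where
  "pathavi_path P zbar lexico k X p d \<longleftrightarrow>
     implicit_extreme_point (feasible_set P) zbar \<and>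
     Mmat P *v zbar + qvec P \<in> affine hull (normal_cone UNIV (feasible_set P) zbar) \<and>
     rvec P \<in> rel_interior (normal_cone UNIV (feasible_set P) zbar) \<and>
     zpart (p 0) = zbar \<and> zpart (d 0) = 0 \<and>
     (if lexico then lex_pivoting_run P k X p d else pivoting_run P 0 k X p d)"

text \<open>
  \<open>R\<close> is a ray of the path in direction \<open>g\<close>, in \<open>(x, t)\<close>-space: the starting ray, directed towards
  increasing \<open>t\<close>, or the secondary ray.
\<close>

definition pathavi_ray :: "('n::finite, 'm::finite) pathavi_data \<Rightarrow> nat
    \<Rightarrow> (nat \<Rightarrow> ('n, 'm) pvar set) \<Rightarrow> (nat \<Rightarrow> ('n, 'm) pt) \<Rightarrow> (nat \<Rightarrow> ('n, 'm) pt)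
    \<Rightarrow> ((real^'n) \<times> real) set \<Rightarrow> (real^'n) \<times> real \<Rightarrow> bool" where
  "pathavi_ray P k X p d R g \<longleftrightarrow>
     (\<exists>c>0. (g = c *\<^sub>R xt_of P (- d 0) \<and> R = halfline (xt_of P (p 0)) g) \<or>
            (g = c *\<^sub>R xt_of P (d k) \<and> R = halfline (xt_of P (p k)) g \<and>
             (\<forall>\<theta>\<ge>0. p k + \<theta> *\<^sub>R d k \<in> sel_piece P 0 (X k)))) \<and>
     ray_in_Gzero UNIV (feasible_set P) (Mmat P) (qvec P) (rvec P) R g"

end

theory Submission
  imports Defs
begin

text \<open>
  Let \<open>L\<close> be the lineality space of \<open>C\<close>.  Since \<open>r\<close> is a normal vector of \<open>C\<close>, it is orthogonal to
  \<open>L\<close>, and so is \<open>x - \<pi>\<^sub>C x\<close>.  Multiplying \<open>G\<^sub>C (x, t) = 0\<close> by \<open>transpose Q\<close> therefore determines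
  \<open>transpose Q *v \<pi>\<^sub>C x\<close> from \<open>transpose Qbar *v \<pi>\<^sub>C x\<close>, and the elimination leaves exactly the reduced
  equation; projections, faces and normal cones of \<open>C\<close> are carried to those of the reduced set.
  If a ray direction \<open>(Dx, Dt)\<close> had \<open>Dx \<in> L\<close>, the projection would move along with \<open>x\<close>, whence
  \<open>M *v Dx = Dt *\<^sub>R r \<bottom> L\<close>, and invertibility of \<open>M\<close> on \<open>L\<close> forces \<open>Dx = 0\<close>.
\<close>

section \<open>Orthonormal basis matrices\<close>

declare transpose_matrix_vector [simp del]

lemma transpose_mult_vec_nth: "(transpose Q *v x) $ i = column i Q \<bullet> x"
  for Q :: "real^'n^'m"
  by (simp add: matrix_vector_mult_def transpose_def column_def inner_vec_def mult.commute)

lemma inner_matrix_transpose: "(Q *v w) \<bullet> x = w \<bullet> (transpose Q *v x)"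
  for Q :: "real^'n^'m"
  by (metis dot_lmul_matrix transpose_matrix_vector inner_commute)

lemma block_id_mult_coord:
  assumes "w \<in> coord_space I"
  shows "block_id I *v w = w"
proof -
  have "(block_id I *v w) $ i = w $ i" for i
  proof -
    have "(block_id I *v w) $ i = (\<Sum>j\<in>UNIV. if j = i then (if i \<in> I then w $ i else 0) else 0)"
      unfolding matrix_vector_mult_def block_id_def vec_lambda_beta by (intro sum.cong) auto
    also have "\<dots> = (if i \<in> I then w $ i else 0)" by simp
    finally show ?thesis using assms by (auto simp: coord_space_def)
  qed
  then show ?thesis by (simp add: vec_eq_iff)
qed

lemma block_inv_mult:
  assumes "block_invertible I A"
  shows "block_inv I A ** A = block_id I"
  using assms unfolding block_invertible_def block_inv_def
  by (metis is_block_inverse_def someI_ex)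

context
  fixes I :: "'n::finite set" and Q :: "real^'n^'n" and S :: "(real^'n) set"
  assumes Q: "orthonormal_basis_matrix I Q S"
begin

lemma orthonormal_basis_subspace: "subspace S"
  using Q by (auto simp: orthonormal_basis_matrix_def)

lemma orthonormal_basis_column: "column i Q \<in> S"
proof (cases "i \<in> I")
  case True
  then show ?thesis using Q by (auto simp: orthonormal_basis_matrix_def intro: span_base)
next
  case False
  then show ?thesis using Q orthonormal_basis_subspace
    by (simp add: orthonormal_basis_matrix_def subspace_0)
qed

lemma orthonormal_basis_mult_in: "Q *v w \<in> S"
  unfolding matrix_mult_sum scalar_mult_eq_scaleR
  by (intro subspace_sum subspace_scale orthonormal_basis_subspace orthonormal_basis_column)

lemma transpose_orthonormal_in_coord_space: "transpose Q *v x \<in> coord_space I"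
  using Q by (simp add: orthonormal_basis_matrix_def coord_space_def transpose_mult_vec_nth)

lemma transpose_orthonormal_eq_0:
  assumes "x \<in> orthogonal_comp S"
  shows "transpose Q *v x = 0"
  using assms orthonormal_basis_column
  by (auto simp: vec_eq_iff transpose_mult_vec_nth orthogonal_comp_def orthogonal_def)

text \<open>The Gram matrix \<open>transpose Q ** Q\<close> equals \<open>block_id I\<close>: its
  entries are the inner products of the columns, and the padding columns outside \<open>I\<close>
  vanish.\<close>

lemma transpose_mult_orthonormal:
  assumes "w \<in> coord_space I"
  shows "transpose Q *v (Q *v w) = w"
proof -
  have "(transpose Q ** Q) $ i $ j = block_id I $ i $ j" for i j
  proof -
    have "(transpose Q ** Q) $ i $ j = column i Q \<bullet> column j Q"
      by (simp add: matrix_matrix_mult_def transpose_def column_def inner_vec_def)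
    then show ?thesis
      using Q unfolding orthonormal_basis_matrix_def block_id_def
      by (cases "i \<in> I"; cases "j \<in> I") auto
  qed
  then have "transpose Q ** Q = block_id I" by (simp add: vec_eq_iff)
  then show ?thesis using assms by (simp add: matrix_vector_mul_assoc block_id_mult_coord)
qed

lemma transpose_orthonormal_eq_0_iff: "transpose Q *v x = 0 \<longleftrightarrow> x \<in> orthogonal_comp S"
proof
  assume 0: "transpose Q *v x = 0"
  have col: "orthogonal x (column i Q)" for i
    using 0 by (metis transpose_mult_vec_nth zero_index orthogonal_def inner_commute)
  have "orthogonal x y" if "y \<in> S" for y
  proof (rule orthogonal_to_span)
    show "y \<in> span ((\<lambda>i. column i Q) ` I)"
      using that Q by (simp add: orthonormal_basis_matrix_def)
  qed (use col in auto)
  then show "x \<in> orthogonal_comp S"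
    by (simp add: orthogonal_comp_def orthogonal_commute)
qed (rule transpose_orthonormal_eq_0)

text \<open>The residual \<open>?y\<close> is orthogonal to \<open>S\<close> because its coordinates
  vanish; it also lies in \<open>S\<close>, hence it is orthogonal to itself.\<close>

lemma orthonormal_mult_transpose:
  assumes "x \<in> S"
  shows "Q *v (transpose Q *v x) = x"
proof -
  let ?y = "x - Q *v (transpose Q *v x)"
  have "transpose Q *v ?y = 0"
    by (simp add: matrix_vector_mult_diff_distrib transpose_mult_orthonormal
        transpose_orthonormal_in_coord_space)
  then have "?y \<in> orthogonal_comp S" by (simp add: transpose_orthonormal_eq_0_iff)
  moreover have "?y \<in> S"
    by (intro subspace_diff orthonormal_basis_subspace orthonormal_basis_mult_in assms)
  ultimately have "?y \<bullet> ?y = 0" by (auto simp: orthogonal_comp_def orthogonal_def)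
  then show ?thesis by simp
qed

end

section \<open>Normal cones and the lineality space\<close>

text \<open>Both \<open>z + v\<close> and \<open>z - v\<close> lie in \<open>C\<close>, so the
  defining inequality holds for either sign of \<open>v\<close>.\<close>

lemma normal_cone_orthogonal_lineality:
  assumes "z \<in> C" "y \<in> normal_cone V C z"
  shows "y \<in> orthogonal_comp (lineality_space C)"
proof -
  have "v \<bullet> y = 0" if "v \<in> lineality_space C" for v
  proof -
    have "z + 1 *\<^sub>R v \<in> C" "z + (-1) *\<^sub>R v \<in> C"
      using that assms(1) unfolding lineality_space_def by blast+
    then have "y \<bullet> (z + 1 *\<^sub>R v - z) \<le> 0" "y \<bullet> (z + (-1) *\<^sub>R v - z) \<le> 0"
      using assms(2) unfolding normal_cone_def by blast+
    then show ?thesis by (simp add: inner_commute)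
  qed
  then show ?thesis by (auto simp: orthogonal_comp_def orthogonal_def)
qed

lemma closest_point_in_normal_cone:
  assumes "convex C" "closed C" "C \<noteq> {}"
  shows "x - closest_point C x \<in> normal_cone UNIV C (closest_point C x)"
  using closest_point_dot[OF assms(1,2)] by (simp add: normal_cone_def)

lemma normal_cone_rel_interior_mono:
  assumes "convex F" "F \<subseteq> C" "z1 \<in> rel_interior F" "z2 \<in> F"
  shows "normal_cone V C z1 \<subseteq> normal_cone V C z2"
proof
  fix y assume y: "y \<in> normal_cone V C z1"
  \<comment> \<open>The segment from \<open>z2\<close> to \<open>z1\<close> can be prolonged past
    \<open>z1\<close> inside \<open>F\<close>. Testing \<open>y\<close> on the prolongation gives
    \<open>y \<bullet> (z1 - z2) \<le> 0\<close>, which moves the inequality from \<open>z1\<close>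
    to \<open>z2\<close>.\<close>
  obtain e where e: "e > 1" "(1 - e) *\<^sub>R z2 + e *\<^sub>R z1 \<in> F"
    using convex_rel_interior_iff[of F z1] assms by blast
  have "y \<bullet> ((1 - e) *\<^sub>R z2 + e *\<^sub>R z1 - z1) \<le> 0"
    using y e assms(2) by (auto simp: normal_cone_def)
  then have "(e - 1) * (y \<bullet> (z1 - z2)) \<le> 0"
    by (simp add: algebra_simps inner_diff_right inner_add_right)
  then have "y \<bullet> (z1 - z2) \<le> 0" using e(1) by (simp add: mult_le_0_iff)
  then have "y \<bullet> (z' - z2) \<le> y \<bullet> (z' - z1)" for z'
    by (simp add: inner_diff_right)
  then show "y \<in> normal_cone V C z2"
    using y by (fastforce simp: normal_cone_def intro: order_trans)
qed

text \<open>The normal cones at two relative interior points of a face contain each other, so the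
  definite description has exactly one candidate.\<close>

lemma face_normal_cone_eq:
  assumes "F face_of C" "convex C" "z \<in> rel_interior F"
  shows "face_normal_cone V C F = normal_cone V C z"
proof -
  have F: "convex F" "F \<subseteq> C"
    using assms face_of_imp_convex face_of_imp_subset by blast+
  have eq: "normal_cone V C z' = normal_cone V C z" if "z' \<in> rel_interior F" for z'
    using normal_cone_rel_interior_mono[OF F] that assms(3) rel_interior_subset
    by (meson subset_antisym subsetD)
  then show ?thesis
    unfolding face_normal_cone_def
    by (intro the_equality ballI eq) (use assms(3) in \<open>auto dest: bspec\<close>)
qed

text \<open>\<open>f\<close> is the midpoint of \<open>f + v\<close> and \<open>f - v\<close>, both
  in \<open>C\<close>, so the face contains these endpoints. For \<open>v = 0\<close> the open
  segment is empty, hence the case split.\<close>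

lemma face_of_add_lineality:
  assumes "F face_of C" "f \<in> F" "v \<in> lineality_space C"
  shows "f + v \<in> F"
proof (cases "v = 0")
  case False
  have f: "f \<in> C" using assms face_of_imp_subset by blast
  have "f + 1 *\<^sub>R v \<in> C" "f + (-1) *\<^sub>R v \<in> C"
    using assms(3) f unfolding lineality_space_def by blast+
  then have C: "f + v \<in> C" "f - v \<in> C" by simp_all
  have "f + v \<noteq> f - v"
  proof
    assume "f + v = f - v"
    then have "(2::real) *\<^sub>R v = 0" by (simp add: scaleR_2 algebra_simps)
    then show False using False by simp
  qed
  then have "midpoint (f + v) (f - v) \<in> open_segment (f + v) (f - v)" by simp
  moreover have "midpoint (f + v) (f - v) = f"
    by (simp add: midpoint_def flip: scaleR_2)
  ultimately show ?thesis using assms(1,2) C unfolding face_of_def by metis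
qed (use assms in simp)

text \<open>Translation by \<open>v\<close> is an isometry mapping \<open>C\<close> onto itself, so
  it commutes with the projection.\<close>

lemma closest_point_add_lineality:
  assumes "convex C" "closed C" "C \<noteq> {}" "v \<in> lineality_space C"
  shows "closest_point C (x + v) = closest_point C x + v"
proof -
  let ?z = "closest_point C x"
  have z: "?z \<in> C" using assms by (simp add: closest_point_in_set)
  have "?z + 1 *\<^sub>R v \<in> C" using assms(4) z unfolding lineality_space_def by blast
  moreover have "dist (x + v) (?z + v) \<le> dist (x + v) y" if "y \<in> C" for y
  proof -
    have "y + (-1) *\<^sub>R v \<in> C" using assms(4) that unfolding lineality_space_def by blast
    then have "dist x ?z \<le> dist x (y - v)" using assms by (simp add: closest_point_le)
    then show ?thesis by (simp add: dist_norm algebra_simps)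
  qed
  ultimately show ?thesis using closest_point_unique[OF assms(1,2)] by (metis scaleR_one)
qed

section \<open>Half-lines under linear maps\<close>

lemma halfline_eq_image: "halfline a d = (\<lambda>\<theta>. a + \<theta> *\<^sub>R d) ` {0..}"
  unfolding halfline_def atLeast_def by blast

lemma halfline_linear_image:
  assumes "linear f"
  shows "f ` halfline a d = halfline (f a) (f d)"
  by (simp add: halfline_eq_image image_image linear_add[OF assms] linear_scale[OF assms])

section \<open>The reduction\<close>

context
  fixes C :: "(real^'n::finite) set" and I J :: "'n set" and Q Qbar :: "real^'n^'n"
  assumes C: "convex C" "closed C" "C \<noteq> {}"
    and Q: "orthonormal_basis_matrix I Q (lineality_space C)"
    and Qbar: "orthonormal_basis_matrix J Qbar (orthogonal_comp (lineality_space C))"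
begin

lemma transpose_Qbar_eq_0_iff: "transpose Qbar *v x = 0 \<longleftrightarrow> x \<in> lineality_space C"
  using transpose_orthonormal_eq_0_iff[OF Qbar] orthonormal_basis_subspace[OF Q]
  by (simp add: orthogonal_comp_self)

lemma orthonormal_decomposition:
  "x = Q *v (transpose Q *v x) + Qbar *v (transpose Qbar *v x)"
proof -
  let ?y = "x - Q *v (transpose Q *v x)"
  have "transpose Q *v ?y = 0"
    by (simp add: matrix_vector_mult_diff_distrib transpose_mult_orthonormal[OF Q]
        transpose_orthonormal_in_coord_space[OF Q])
  then have "?y \<in> orthogonal_comp (lineality_space C)"
    by (simp add: transpose_orthonormal_eq_0_iff[OF Q])
  then have "Qbar *v (transpose Qbar *v ?y) = ?y"
    by (rule orthonormal_mult_transpose[OF Qbar])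
  moreover have "transpose Qbar *v (Q *v (transpose Q *v x)) = 0"
    by (simp add: transpose_Qbar_eq_0_iff orthonormal_basis_mult_in[OF Q])
  ultimately show ?thesis
    by (simp add: matrix_vector_mult_diff_distrib algebra_simps)
qed

section \<open>Inner products, projections, faces and cells of the reduced set\<close>

lemma inner_transpose_Qbar:
  assumes "y \<in> orthogonal_comp (lineality_space C)"
  shows "(transpose Qbar *v y) \<bullet> (transpose Qbar *v x) = y \<bullet> x"
  by (metis inner_matrix_transpose orthonormal_mult_transpose[OF Qbar assms])

text \<open>Removing the lineality component of a point of \<open>C\<close> does not leave
  \<open>C\<close>. Linear images of closed sets need not be closed; this description as a preimage
  within a coordinate subspace yields closedness.\<close>

lemma reduced_set_eq: "reduced_set Qbar C = {w \<in> coord_space J. Qbar *v w \<in> C}"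
proof (intro set_eqI iffI)
  fix w assume "w \<in> reduced_set Qbar C"
  then obtain z where z: "z \<in> C" "w = transpose Qbar *v z" by (auto simp: reduced_set_def)
  have "z + (-1) *\<^sub>R (Q *v (transpose Q *v z)) \<in> C"
    using orthonormal_basis_mult_in[OF Q] z unfolding lineality_space_def by blast
  moreover have "z + (-1) *\<^sub>R (Q *v (transpose Q *v z)) = Qbar *v w"
    using orthonormal_decomposition[of z] z(2) by (simp add: algebra_simps)
  ultimately show "w \<in> {w \<in> coord_space J. Qbar *v w \<in> C}"
    using z transpose_orthonormal_in_coord_space[OF Qbar] by simp
next
  fix w assume "w \<in> {w \<in> coord_space J. Qbar *v w \<in> C}"
  then show "w \<in> reduced_set Qbar C"
    unfolding reduced_set_def using transpose_mult_orthonormal[OF Qbar]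
    by (metis (mono_tags, lifting) imageI mem_Collect_eq)
qed

lemma convex_reduced_set: "convex (reduced_set Qbar C)"
  unfolding reduced_set_def using C by (intro convex_linear_image) auto

lemma closed_reduced_set: "closed (reduced_set Qbar C)"
proof -
  have 1: "closed (coord_space J :: (real^'n) set)"
    unfolding coord_space_def
    by (intro closed_Collect_all closed_Collect_imp open_Collect_const closed_Collect_eq
        continuous_intros)
  have 2: "closed ((\<lambda>w. Qbar *v w) -` C)"
    using C by (intro continuous_closed_vimage) (simp_all add: matrix_vector_mult_linear_continuous_at)
  have "reduced_set Qbar C = coord_space J \<inter> ((\<lambda>w. Qbar *v w) -` C)"
    unfolding reduced_set_eq by auto
  with 1 2 show ?thesis by auto
qed

text \<open>Normal vectors are orthogonal to the lineality space, and for them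
  \<open>transpose Qbar\<close> preserves inner products with arbitrary vectors.\<close>

lemma normal_cone_reduced:
  assumes "z \<in> C" "y \<in> normal_cone UNIV C z"
  shows "transpose Qbar *v y \<in> normal_cone (coord_space J) (reduced_set Qbar C) (transpose Qbar *v z)"
proof -
  have y: "y \<in> orthogonal_comp (lineality_space C)"
    using assms by (rule normal_cone_orthogonal_lineality)
  have "(transpose Qbar *v y) \<bullet> (transpose Qbar *v z' - transpose Qbar *v z) \<le> 0"
    if "z' \<in> C" for z'
    using inner_transpose_Qbar[OF y, of "z' - z"] assms that
    by (simp add: normal_cone_def matrix_vector_mult_diff_distrib)
  then show ?thesis
    using transpose_orthonormal_in_coord_space[OF Qbar]
    by (auto simp: normal_cone_def reduced_set_def)
qed

text \<open>The residual of a projection is a normal vector, its image is a normal vector of the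
  reduced set, and this property characterizes the closest point.\<close>

lemma closest_point_reduced:
  "closest_point (reduced_set Qbar C) (transpose Qbar *v x) = transpose Qbar *v closest_point C x"
proof -
  let ?z = "closest_point C x"
  have z: "?z \<in> C" using C by (simp add: closest_point_in_set)
  have N: "transpose Qbar *v (x - ?z) \<in>
      normal_cone (coord_space J) (reduced_set Qbar C) (transpose Qbar *v ?z)"
    using z closest_point_in_normal_cone[OF C] by (rule normal_cone_reduced)
  have "dist (transpose Qbar *v x) (transpose Qbar *v ?z) \<le> dist (transpose Qbar *v x) w"
    if "w \<in> reduced_set Qbar C" for w
  proof -
    let ?a = "transpose Qbar *v x - transpose Qbar *v ?z" and ?b = "w - transpose Qbar *v ?z"
    have "?a \<bullet> ?b \<le> 0"
      using N that by (simp add: normal_cone_def matrix_vector_mult_diff_distrib)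
    \<comment> \<open>\<open>?a - ?b\<close> is the vector from \<open>w\<close> to the image of
      \<open>x\<close>; the sign of the cross term makes it at least as long as
      \<open>?a\<close>.\<close>
    moreover have "(norm (?a - ?b))\<^sup>2 = (norm ?a)\<^sup>2 + (norm ?b)\<^sup>2 - 2 * (?a \<bullet> ?b)"
      using dot_norm_neg[of ?a ?b] by (simp add: field_simps)
    ultimately have "(norm ?a)\<^sup>2 \<le> (norm (?a - ?b))\<^sup>2"
      using zero_le_power2[of "norm ?b"] by linarith
    then have "norm ?a \<le> norm (?a - ?b)" by (simp add: norm_le power2_norm_eq_inner)
    then show ?thesis by (simp add: dist_norm)
  qed
  moreover have "transpose Qbar *v ?z \<in> reduced_set Qbar C" using z by (simp add: reduced_set_def)
  ultimately show ?thesis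
    using closest_point_unique[OF convex_reduced_set closed_reduced_set] by metis
qed

text \<open>Faces are invariant under translation along the lineality space, so the face property
  can be tested on segments lifted to \<open>C\<close>.\<close>

lemma face_of_reduced:
  assumes "F face_of C"
  shows "(\<lambda>z. transpose Qbar *v z) ` F face_of reduced_set Qbar C"
  unfolding face_of_def
proof (intro conjI ballI impI)
  show "(\<lambda>z. transpose Qbar *v z) ` F \<subseteq> reduced_set Qbar C"
    using assms face_of_imp_subset unfolding reduced_set_def by blast
  show "convex ((\<lambda>z. transpose Qbar *v z) ` F)"
    using assms face_of_imp_convex C by (intro convex_linear_image) auto
next
  fix a' b' w
  assume a': "a' \<in> reduced_set Qbar C" and b': "b' \<in> reduced_set Qbar C"
    and w: "w \<in> (\<lambda>z. transpose Qbar *v z) ` F" and seg: "w \<in> open_segment a' b'"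
  obtain a b z where abz: "a \<in> C" "a' = transpose Qbar *v a" "b \<in> C" "b' = transpose Qbar *v b"
    "z \<in> F" "w = transpose Qbar *v z"
    using a' b' w by (auto simp: reduced_set_def)
  obtain u where u: "a' \<noteq> b'" "0 < u" "u < 1" "w = (1 - u) *\<^sub>R a' + u *\<^sub>R b'"
    using seg by (auto simp: in_segment)
  \<comment> \<open>The point of the lifted segment above \<open>w\<close>. It has the same image as
    \<open>z\<close>, so the two differ by a vector of the lineality space and \<open>?c\<close>
    lies in \<open>F\<close>.\<close>
  let ?c = "(1 - u) *\<^sub>R a + u *\<^sub>R b"
  have "transpose Qbar *v (?c - z) = 0"
    using u abz by (simp add: matrix_vector_mult_diff_distrib matrix_vector_right_distrib
        matrix_vector_mult_scaleR)
  then have "z + (?c - z) \<in> F"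
    using assms abz(5) by (intro face_of_add_lineality) (auto simp: transpose_Qbar_eq_0_iff)
  moreover have "?c \<in> open_segment a b" using u abz by (auto simp: in_segment)
  ultimately have "a \<in> F" "b \<in> F"
    using face_ofD[OF assms, of ?c a b] abz(1,3) by simp_all
  then show "a' \<in> (\<lambda>z. transpose Qbar *v z) ` F" "b' \<in> (\<lambda>z. transpose Qbar *v z) ` F"
    using abz by auto
qed

text \<open>A linear map carries the relative interior of \<open>F\<close> onto that of its image,
  so both face normal cones can be evaluated at corresponding points \<open>z\<close> and
  \<open>?f z\<close>.\<close>

lemma top_cell_reduced:
  assumes "\<sigma> \<in> top_cells UNIV C"
  shows "\<exists>\<sigma>'\<in>top_cells (coord_space J) (reduced_set Qbar C).
    (\<lambda>(x, t). (transpose Qbar *v x, t)) ` \<sigma> \<subseteq> \<sigma>'"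
proof -
  let ?f = "\<lambda>z. transpose Qbar *v z" and ?C = "reduced_set Qbar C" and ?V = "coord_space J"
  obtain F where F: "F face_of C" "F \<noteq> {}"
    and \<sigma>: "\<sigma> = {f + y | f y. f \<in> F \<and> y \<in> face_normal_cone UNIV C F} \<times> {0..}"
    using assms by (auto simp: top_cells_def)
  have convF: "convex F" using F C face_of_imp_convex by auto
  then obtain z where z: "z \<in> rel_interior F" using F rel_interior_eq_empty by auto
  then have zC: "z \<in> C" using F rel_interior_subset face_of_imp_subset by blast
  have F': "?f ` F face_of ?C" by (rule face_of_reduced[OF F(1)])
  have z': "?f z \<in> rel_interior (?f ` F)"
    using z rel_interior_convex_linear_image[OF matrix_vector_mul_linear convF] by blast
  have N: "?f y \<in> face_normal_cone ?V ?C (?f ` F)" if "y \<in> face_normal_cone UNIV C F" for y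
    using normal_cone_reduced[OF zC, of y] that
      face_normal_cone_eq[OF F(1) C(1) z] face_normal_cone_eq[OF F' convex_reduced_set z'] by simp
  let ?S = "{f + y | f y. f \<in> ?f ` F \<and> y \<in> face_normal_cone ?V ?C (?f ` F)} \<times> {0::real..}"
  have "?S \<in> top_cells ?V ?C" unfolding top_cells_def using F F' by blast
  moreover have "(?f (f + y), t) \<in> ?S" if "f \<in> F" "y \<in> face_normal_cone UNIV C F" "0 \<le> t" for f y t
    using that N matrix_vector_right_distrib[of "transpose Qbar" f y] by auto
  then have "(\<lambda>(x, t). (?f x, t)) ` \<sigma> \<subseteq> ?S"
    unfolding \<sigma> by fastforce
  ultimately show ?thesis by blast
qed

section \<open>Elimination of the lineality component\<close>

context
  fixes M :: "real^'n^'n" and r :: "real^'n"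
  assumes inv: "block_invertible I (transpose Q ** M ** Q)"
    and r: "r \<in> orthogonal_comp (lineality_space C)"
begin

text \<open>Block elimination: the \<open>Q\<close> component of the equation is solved for
  \<open>zq\<close>, and substitution into the \<open>Qbar\<close> component produces the Schur
  complement \<open>reduced_matrix\<close>.\<close>

lemma Gzero_reduced:
  assumes "(x, t) \<in> Gzero UNIV C M q r"
  shows "(transpose Qbar *v x, t) \<in>
    Gzero (coord_space J) (reduced_set Qbar C) (reduced_matrix I Q Qbar M)
      (reduced_q I Q Qbar M q) (reduced_r Qbar r)"
proof -
  define z where "z = closest_point C x"
  define y where "y = x - z"
  define zq where "zq = transpose Q *v z"
  define zt where "zt = transpose Qbar *v z"
  define N where "N = block_inv I (transpose Q ** M ** Q)"
  have G: "M *v z + q + y - t *\<^sub>R r = 0" and t: "0 \<le> t"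
    using assms by (auto simp: Gzero_def Gmap_def z_def y_def algebra_simps)
  have "z \<in> C" unfolding z_def using C by (simp add: closest_point_in_set)
  then have y: "transpose Q *v y = 0"
    unfolding y_def z_def using closest_point_in_normal_cone[OF C]
    by (metis normal_cone_orthogonal_lineality transpose_orthonormal_eq_0[OF Q])
  have r0: "transpose Q *v r = 0" by (rule transpose_orthonormal_eq_0[OF Q r])
  have dec: "M *v z = M *v (Q *v zq) + M *v (Qbar *v zt)"
    using orthonormal_decomposition[of z] unfolding zq_def zt_def
    by (metis matrix_vector_right_distrib)
  have "transpose Q *v (M *v z + q + y - t *\<^sub>R r) = 0" using G by simp
  then have "transpose Q *v (M *v (Q *v zq)) + transpose Q *v (M *v (Qbar *v zt)) + transpose Q *v q = 0"
    by (simp add: dec matrix_vector_right_distrib matrix_vector_mult_diff_distrib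
        matrix_vector_mult_scaleR y r0)
  then have "N *v (transpose Q *v (M *v (Q *v zq)) + transpose Q *v (M *v (Qbar *v zt))
      + transpose Q *v q) = 0" by simp
  moreover have "N *v (transpose Q *v (M *v (Q *v zq))) = zq"
  proof -
    have "N *v (transpose Q *v (M *v (Q *v zq))) = (N ** (transpose Q ** M ** Q)) *v zq"
      by (simp add: matrix_vector_mul_assoc matrix_mul_assoc)
    also have "\<dots> = zq"
      unfolding N_def block_inv_mult[OF inv] zq_def
      by (rule block_id_mult_coord[OF transpose_orthonormal_in_coord_space[OF Q]])
    finally show ?thesis .
  qed
  ultimately have "zq + (N *v (transpose Q *v (M *v (Qbar *v zt))) + N *v (transpose Q *v q)) = 0"
    by (simp add: matrix_vector_right_distrib add.assoc)
  then have zq: "zq = - (N *v (transpose Q *v (M *v (Qbar *v zt))) + N *v (transpose Q *v q))"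
    by (simp only: eq_neg_iff_add_eq_0)
  let ?B = "\<lambda>v. transpose Qbar *v (M *v (Q *v v))"
  have B: "?B zq = - (?B (N *v (transpose Q *v (M *v (Qbar *v zt)))) + ?B (N *v (transpose Q *v q)))"
    by (subst zq) (simp only: matrix_vector_right_distrib linear_neg[OF matrix_vector_mul_linear])
  have "transpose Qbar *v (M *v z + q + y - t *\<^sub>R r) = 0" using G by simp
  then have "?B zq + transpose Qbar *v (M *v (Qbar *v zt)) + transpose Qbar *v q
      + (transpose Qbar *v x - zt) - t *\<^sub>R (transpose Qbar *v r) = 0"
    by (simp add: dec matrix_vector_right_distrib matrix_vector_mult_diff_distrib
        matrix_vector_mult_scaleR y_def zt_def)
  moreover have "reduced_matrix I Q Qbar M *v zt =
      transpose Qbar *v (M *v (Qbar *v zt)) - ?B (N *v (transpose Q *v (M *v (Qbar *v zt))))"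
    unfolding reduced_matrix_def N_def[symmetric]
    by (simp only: matrix_vector_mult_diff_rdistrib matrix_vector_mul_assoc[symmetric])
  moreover have "reduced_q I Q Qbar M q = transpose Qbar *v q - ?B (N *v (transpose Q *v q))"
    unfolding reduced_q_def N_def[symmetric]
    by (simp only: matrix_vector_mult_diff_rdistrib matrix_vector_mul_assoc[symmetric])
  \<comment> \<open>Here \<open>bz\<close> stands for \<open>?B zq\<close>, \<open>a - u\<close> for
    the reduced matrix applied to \<open>zt\<close>, and \<open>b - v\<close> for the reduced
    constant term.\<close>
  moreover have "(a - u) + (b - v) + x' - zt - s = 0"
    if "bz + a + b + (x' - zt) - s = 0" "bz = - (u + v)" for a b u v bz x' s :: "real^'n"
    using that by (simp add: algebra_simps)
  ultimately have "Gmap (reduced_set Qbar C) (reduced_matrix I Q Qbar M)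
      (reduced_q I Q Qbar M q) (reduced_r Qbar r) (transpose Qbar *v x, t) = 0"
    using B unfolding Gmap_def closest_point_reduced reduced_r_def prod.case
      z_def[symmetric] zt_def[symmetric] by presburger
  then show ?thesis
    using t transpose_orthonormal_in_coord_space[OF Qbar] by (simp add: Gzero_def)
qed

lemma Gzero_direction_in_lineality:
  assumes "(x, t) \<in> Gzero UNIV C M q r" "(x + Dx, t + Dt) \<in> Gzero UNIV C M q r"
    and Dx: "Dx \<in> lineality_space C"
  shows "Dx = 0"
proof -
  have G: "M *v closest_point C x + q + x - closest_point C x - t *\<^sub>R r = 0"
    "M *v (closest_point C x + Dx) + q + (x + Dx) - (closest_point C x + Dx) - (t + Dt) *\<^sub>R r = 0"
    using assms by (simp_all add: Gzero_def Gmap_def closest_point_add_lineality[OF C Dx])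
  \<comment> \<open>Subtracting the two equations cancels \<open>q\<close> and the normal part,
    since the projection moves by \<open>Dx\<close> as well.\<close>
  have "M *v Dx - Dt *\<^sub>R r =
      (M *v (closest_point C x + Dx) + q + (x + Dx) - (closest_point C x + Dx) - (t + Dt) *\<^sub>R r)
      - (M *v closest_point C x + q + x - closest_point C x - t *\<^sub>R r)"
    by (simp add: matrix_vector_right_distrib scaleR_add_left)
  then have "M *v Dx = Dt *\<^sub>R r" unfolding G by simp
  then have 0: "transpose Q *v (M *v Dx) = 0"
    using transpose_orthonormal_eq_0[OF Q r] by (simp add: matrix_vector_mult_scaleR)
  have Q': "Q *v (transpose Q *v Dx) = Dx" by (rule orthonormal_mult_transpose[OF Q Dx])
  let ?A = "transpose Q ** M ** Q"
  \<comment> \<open>The inverse of the block recovers the coordinates of \<open>Dx\<close> from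
    \<open>transpose Q *v (M *v Dx)\<close>, which is zero.\<close>
  have "transpose Q *v Dx = (block_inv I ?A ** ?A) *v (transpose Q *v Dx)"
    unfolding block_inv_mult[OF inv]
    by (rule block_id_mult_coord[OF transpose_orthonormal_in_coord_space[OF Q], symmetric])
  also have "\<dots> = block_inv I ?A *v (transpose Q *v (M *v (Q *v (transpose Q *v Dx))))"
    by (simp add: matrix_vector_mul_assoc matrix_mul_assoc)
  also have "\<dots> = 0" by (simp add: Q' 0)
  finally show ?thesis using Q' by simp
qed

lemma ray_reduced:
  assumes R: "ray_in_Gzero UNIV C M q r R (Dx, Dt)" and Dx: "Dx \<noteq> 0"
  shows "transpose Qbar *v Dx \<noteq> 0"
    and "ray_in_Gzero (coord_space J) (reduced_set Qbar C) (reduced_matrix I Q Qbar M)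
      (reduced_q I Q Qbar M q) (reduced_r Qbar r)
      ((\<lambda>(x, t). (transpose Qbar *v x, t)) ` R) (transpose Qbar *v Dx, Dt)"
proof -
  let ?f = "\<lambda>(x, t). (transpose Qbar *v x, t :: real)"
  obtain x0 t0 \<sigma> where a: "R = halfline (x0, t0) (Dx, Dt)" and sub: "R \<subseteq> Gzero UNIV C M q r"
    and \<sigma>: "\<sigma> \<in> top_cells UNIV C" "R \<subseteq> \<sigma>"
    using R unfolding ray_in_Gzero_def by force
  have "(x0, t0) + \<theta> *\<^sub>R (Dx, Dt) \<in> R" if "0 \<le> \<theta>" for \<theta>
    using that unfolding a halfline_def by blast
  \<comment> \<open>The parameters 0 and 1 give two zeros whose difference is the direction of the
    ray.\<close>
  from this[of 0] this[of 1] have "(x0, t0) \<in> R" "(x0 + Dx, t0 + Dt) \<in> R" by simp_all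
  then have "(x0, t0) \<in> Gzero UNIV C M q r" "(x0 + Dx, t0 + Dt) \<in> Gzero UNIV C M q r"
    using sub by auto
  then show *: "transpose Qbar *v Dx \<noteq> 0"
    using Gzero_direction_in_lineality Dx by (auto simp: transpose_Qbar_eq_0_iff)
  have lin: "linear ?f"
    by (rule linearI) (auto simp: matrix_vector_right_distrib matrix_vector_mult_scaleR)
  have "?f ` R = halfline (?f (x0, t0)) (transpose Qbar *v Dx, Dt)"
    unfolding a halfline_linear_image[OF lin] by simp
  moreover have "?f ` R \<subseteq> Gzero (coord_space J) (reduced_set Qbar C) (reduced_matrix I Q Qbar M)
      (reduced_q I Q Qbar M q) (reduced_r Qbar r)"
    using sub by (auto intro: Gzero_reduced)
  moreover obtain \<sigma>' where "\<sigma>' \<in> top_cells (coord_space J) (reduced_set Qbar C)" "?f ` R \<subseteq> \<sigma>'"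
    using top_cell_reduced[OF \<sigma>(1)] \<sigma>(2) by (meson image_mono order_trans)
  ultimately show "ray_in_Gzero (coord_space J) (reduced_set Qbar C) (reduced_matrix I Q Qbar M)
      (reduced_q I Q Qbar M q) (reduced_r Qbar r) (?f ` R) (transpose Qbar *v Dx, Dt)"
    unfolding ray_in_Gzero_def using * by (auto simp: prod_eq_iff)
qed

end

end

section \<open>The feasible set\<close>

lemma convex_closed_kind_set: "convex (kind_set k)" "closed (kind_set k)"
  by (cases k; simp)+

text \<open>Bounds may be infinite; the interval property and the continuity of \<open>ereal\<close>
  treat all cases at once.\<close>

lemma convex_closed_ereal_bounds:
  "convex {x::real. a \<le> ereal x \<and> ereal x \<le> b}" "closed {x::real. a \<le> ereal x \<and> ereal x \<le> b}"
proof -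
  let ?S = "{x::real. a \<le> ereal x \<and> ereal x \<le> b}"
  have "is_interval ?S"
    unfolding is_interval_1 by (auto simp flip: ereal_less_eq(3) intro: order_trans)
  then show "convex ?S" by (rule is_interval_convex)
  show "closed ?S"
    by (intro closed_Collect_conj closed_Collect_le continuous_intros)
qed

lemma feasible_set_eq:
  "feasible_set P = (\<Inter>i. (\<lambda>z. (Amat P *v z) $ i - bvec P $ i) -` kind_set (kind P i)) \<inter>
     (\<Inter>j. (\<lambda>z. z $ j) -` {x. lbd P $ j \<le> ereal x \<and> ereal x \<le> ubd P $ j})"
  by (auto simp: feasible_set_def cone_product_def within_bounds_def)

lemma closed_feasible_set: "closed (feasible_set P)"
proof -
  have "continuous_on UNIV (\<lambda>z. (Amat P *v z) $ i - bvec P $ i)" for i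
    by (intro continuous_intros linear_continuous_on matrix_vector_mul_bounded_linear)
  then show ?thesis
    unfolding feasible_set_eq
    by (intro closed_Int closed_INT ballI closed_vimage convex_closed_kind_set
        convex_closed_ereal_bounds continuous_intros)
qed

lemma convex_feasible_set: "convex (feasible_set P)"
proof -
  have "convex ((\<lambda>z. (Amat P *v z) $ i - bvec P $ i) -` kind_set (kind P i))" for i
  proof -
    \<comment> \<open>The offset \<open>bvec P $ i\<close> is moved into the target set, so that the
      preimage is taken under a linear map.\<close>
    have "(\<lambda>z. (Amat P *v z) $ i - bvec P $ i) -` kind_set (kind P i) =
      (\<lambda>z. (Amat P *v z) $ i) -` ((+) (bvec P $ i) ` kind_set (kind P i))"
      by (auto simp: image_iff algebra_simps) (metis diff_add_cancel)
    moreover have "linear (\<lambda>z. (Amat P *v z) $ i)"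
      by (rule linearI) (auto simp: matrix_vector_right_distrib matrix_vector_mult_scaleR)
    ultimately show ?thesis
      by (simp add: convex_linear_vimage convex_translation convex_closed_kind_set)
  qed
  moreover have "convex ((\<lambda>z::real^'a. z $ j) -` {x. lbd P $ j \<le> ereal x \<and> ereal x \<le> ubd P $ j})" for j
    by (intro convex_linear_vimage convex_closed_ereal_bounds linearI) auto
  ultimately show ?thesis
    unfolding feasible_set_eq by (intro convex_Int convex_INT) auto
qed

section \<open>Rays of the generated path\<close>

theorem proposition3p8:
  fixes C :: "(real^'n) set" and M :: "real^'n^'n" and q r zbar :: "real^'n"
    and A :: "real^'n^'m" and b :: "real^'m" and K :: "'m \<Rightarrow> cone_kind" and l u :: "ereal^'n"
    and P :: "('n, 'm) pathavi_data"
    and I J :: "'n set" and Q Qbar :: "real^'n^'n"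
    and lexico :: bool and k :: nat and X :: "nat \<Rightarrow> ('n, 'm) pvar set"
    and p d :: "nat \<Rightarrow> ('n, 'm) pt"
    and R :: "((real^'n) \<times> real) set" and Dx :: "real^'n" and Dt :: real
  assumes "P = \<lparr>Mmat = M, qvec = q, rvec = r, Amat = A, bvec = b, kind = K, lbd = l, ubd = u\<rparr>"
    and "C = {z. A *v z - b \<in> cone_product K \<and>
                 (\<forall>j. l $ j \<le> ereal (z $ j) \<and> ereal (z $ j) \<le> u $ j)}"
    and "C \<noteq> {}"
    and "orthonormal_basis_matrix I Q (lineality_space C)"
    and "orthonormal_basis_matrix J Qbar (orthogonal_comp (lineality_space C))"
    and "block_invertible I (transpose Q ** M ** Q)"
    and "pathavi_path P zbar lexico k X p d"
    and "regular_value_zero C M q r \<or> lexico"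
    and "pathavi_ray P k X p d R (Dx, Dt)"
    and "(Dx, Dt) \<noteq> 0"
  shows "Dx \<noteq> 0 \<longrightarrow>
    transpose Qbar *v Dx \<noteq> 0 \<and>
    ray_in_Gzero (coord_space J) (reduced_set Qbar C) (reduced_matrix I Q Qbar M)
      (reduced_q I Q Qbar M q) (reduced_r Qbar r)
      ((\<lambda>(x, t). (transpose Qbar *v x, t)) ` R) (transpose Qbar *v Dx, Dt)"
proof -
  have CP: "C = feasible_set P"
    using assms(1,2) by (simp add: feasible_set_def within_bounds_def)
  have C: "convex C" "closed C"
    unfolding CP by (rule convex_feasible_set closed_feasible_set)+
  \<comment> \<open>The choice of \<open>r\<close> in the relative interior of the normal cone at
    \<open>zbar\<close> makes it a normal vector, hence orthogonal to the lineality space.\<close>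
  have "zbar \<in> C" "r \<in> normal_cone UNIV C zbar"
    using assms(1,7) rel_interior_subset
    by (auto simp: pathavi_path_def implicit_extreme_point_def CP)
  then have r: "r \<in> orthogonal_comp (lineality_space C)"
    by (rule normal_cone_orthogonal_lineality)
  \<comment> \<open>Starting and secondary rays are treated alike: both are half-lines of zeros
    inside one top cell.\<close>
  have "ray_in_Gzero UNIV C M q r R (Dx, Dt)"
    using assms(1,9) by (simp add: pathavi_ray_def CP)
  then show ?thesis
    using ray_reduced[OF C assms(3-6) r] by blast
qed

end
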